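(* Let $X(t)$, $t\ge 0$, be a switch process with expected value function $E(t)=\mathbb{E}[X(t)]$ and switching time distribution $F$. Then the following conditions are equivalent: (i) $F\in GD(2)$; (ii) $E(t)$ is non-negative and decreasing (in the sense of non-increasing) in $t\ge 0$.
   Context: Switch process: let $(T_k)_{k\ge 1}$ be i.i.d. non-negative random variables with distribution function $F$ (the switching time distribution). Standing assumptions: $F$ is absolutely continuous with respect to Lebesgue measure, with a density $f$ that is bounded on any closed interval of the positive half-line, $F$ has support on $(0,\infty)$, $f(t)$ is well defined at each $t\in(0,\infty)$, and $F(0)=0$. Define $N(t)=\sup\{n\in\mathbb{N}:\sum_{k=1}^n T_k\le t\}$ for $t\ge T_1$ and $N(t)=0$ for $0\le t<T_1$. The switch process is $X(t)=(-1)^{N(t)}$, $t\ge 0$. Geometric divisibility: for $r>1$, a distribution $F$ of a non-negative random variable $W$ belongs to $GD(r)$ ($r$-geometric divisible) if $W$ has the same distribution as $\sum_{k=1}^{\nu_p}\tilde W_k$, where $\nu_p$ is geometric with $P(\nu_p=k)=(1-p)^{k-1}p$, $k=1,2,\dots$, $r=\mathbb{E}\nu_p=1/p$, and $(\tilde W_k)_{k\ge1}$ are i.i.d. non-negative random variables independent of $\nu_p$. *)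

theory Defs
  imports "HOL-Probability.Probability"
begin

text \<open>
  Distributions are represented by their laws (Borel probability measures on the reals); the
  distribution function of \<open>F\<close> is \<open>cdf F\<close>. A ``closed interval of the positive half-line'' is
  read as \<open>[a, b]\<close> with \<open>0 < a\<close>, so \<open>f\<close> may be unbounded near \<open>0\<close> and need not vanish at infinity.
  ``Support on \<open>(0, \<infinity>)\<close>'' means that \<open>F\<close> is concentrated there.
\<close>

definition switching_time_distribution :: "real measure \<Rightarrow> bool" where
  "switching_time_distribution F \<longleftrightarrow>
     real_distribution F \<and>
     (\<exists>f :: real \<Rightarrow> real.
        f \<in> borel_measurable borel \<and> (\<forall>x. 0 \<le> f x) \<and>
        F = density lborel (\<lambda>x. ennreal (f x)) \<and>
        (\<forall>a b. 0 < a \<longrightarrow> a \<le> b \<longrightarrow> bounded (f ` {a..b}))) \<and>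
     measure F {0<..} = 1 \<and>
     cdf F 0 = 0"

text \<open>All sequences are indexed by \<open>k \<ge> 1\<close>; the value at index \<open>0\<close> is irrelevant.\<close>

definition iid_nonneg :: "'a measure \<Rightarrow> (nat \<Rightarrow> 'a \<Rightarrow> real) \<Rightarrow> real measure \<Rightarrow> bool" where
  "iid_nonneg M T F \<longleftrightarrow>
     prob_space.indep_vars M (\<lambda>_. borel) T {1..} \<and>
     (\<forall>k\<ge>1. distr M borel (T k) = F) \<and>
     (\<forall>k\<ge>1. AE \<omega> in M. 0 \<le> T k \<omega>)"

text \<open>
  The set below is finite almost surely for a switching time distribution; on the exceptional
  null set \<open>Sup\<close> returns an unspecified but fixed natural number.
\<close>

definition switch_count :: "(nat \<Rightarrow> 'a \<Rightarrow> real) \<Rightarrow> real \<Rightarrow> 'a \<Rightarrow> nat" where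
  "switch_count T t \<omega> = (if T 1 \<omega> \<le> t then Sup {n. (\<Sum>k=1..n. T k \<omega>) \<le> t} else 0)"

definition switch_process :: "(nat \<Rightarrow> 'a \<Rightarrow> real) \<Rightarrow> real \<Rightarrow> 'a \<Rightarrow> real" where
  "switch_process T t \<omega> = (- 1) ^ switch_count T t \<omega>"

definition expected_value :: "'a measure \<Rightarrow> (nat \<Rightarrow> 'a \<Rightarrow> real) \<Rightarrow> real \<Rightarrow> real" where
  "expected_value M T t = prob_space.expectation M (switch_process T t)"

text \<open>
  \<open>geometric_sum M \<nu> W p F\<close>: on the probability space \<open>M\<close>, the random sum \<open>W\<^sub>1 + \<dots> + W\<^sub>\<nu>\<close> has law \<open>F\<close>,
  where \<open>\<nu>\<close> is geometric on \<open>{1, 2, \<dots>}\<close> with success probability \<open>p\<close>, the \<open>W\<^sub>k\<close> are i.i.d. and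
  non-negative, and \<open>\<nu>\<close> is independent of the whole sequence. Independence is stated for the generated
  \<open>\<sigma>\<close>-algebras because \<^const>\<open>prob_space.indep_var\<close> requires both variables to have the same type.
\<close>

definition geometric_sum ::
  "'a measure \<Rightarrow> ('a \<Rightarrow> nat) \<Rightarrow> (nat \<Rightarrow> 'a \<Rightarrow> real) \<Rightarrow> real \<Rightarrow> real measure \<Rightarrow> bool" where
  "geometric_sum M \<nu> W p F \<longleftrightarrow>
     prob_space M \<and>
     (\<exists>G. iid_nonneg M W G) \<and>
     \<nu> \<in> measurable M (count_space UNIV) \<and>
     prob_space.indep_set M
       {\<nu> -` A \<inter> space M | A. A \<in> sets (count_space UNIV)}
       {(\<lambda>\<omega>. \<lambda>k\<in>{1..}. W k \<omega>) -` B \<inter> space M | B.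
          B \<in> sets (\<Pi>\<^sub>M k\<in>{1..}. (borel :: real measure))} \<and>
     (\<forall>k\<ge>1. measure M {\<omega> \<in> space M. \<nu> \<omega> = k} = (1 - p) ^ (k - 1) * p) \<and>
     distr M borel (\<lambda>\<omega>. \<Sum>k=1..\<nu> \<omega>. W k \<omega>) = F"

text \<open>
  The class \<open>GD(r)\<close>. HOL cannot quantify over the type of the sample space, so the canonical one
  \<open>\<nat> \<times> \<real>\<^bsup>\<nat>\<^esup>\<close> is used; \<open>GD_I\<close> below shows that
  a representation on any other sample space suffices. Since \<open>r = E \<nu> = 1 / p\<close>, the parameter is \<open>p = 1 / r\<close>.
\<close>

definition GD :: "real \<Rightarrow> real measure set" where
  "GD r = {F. 1 < r \<and>
     (\<exists>(M :: (nat \<times> (nat \<Rightarrow> real)) measure) \<nu> W. geometric_sum M \<nu> W (1 / r) F)}"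

lemma GD_I:
  fixes M :: "'a measure"
  assumes "1 < r" and gs: "geometric_sum M \<nu> W (1 / r) F"
  shows "F \<in> GD r"
proof -
  note One_nat_def [simp del]
  let ?P = "\<Pi>\<^sub>M k\<in>{1::nat..}. (borel :: real measure)"
  let ?C = "count_space (UNIV :: nat set)"
  define S where "S \<omega> = (\<lambda>k\<in>{1::nat..}. W k \<omega>)" for \<omega>
  define \<Phi> where "\<Phi> \<omega> = (\<nu> \<omega>, S \<omega>)" for \<omega>
  define M' where "M' = distr M (?C \<Otimes>\<^sub>M ?P) \<Phi>"
  define W' :: "nat \<Rightarrow> nat \<times> (nat \<Rightarrow> real) \<Rightarrow> real" where "W' k x = snd x k" for k x
  obtain G where iid: "iid_nonneg M W G"
    using gs by (auto simp: geometric_sum_def)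
  interpret prob_space M
    using gs by (simp add: geometric_sum_def)
  have ind: "indep_vars (\<lambda>_. borel) W {1..}"
    and lawW: "\<And>k. k \<ge> 1 \<Longrightarrow> distr M borel (W k) = G"
    and nonneg: "\<And>k. k \<ge> 1 \<Longrightarrow> AE \<omega> in M. 0 \<le> W k \<omega>"
    using iid by (auto simp: iid_nonneg_def)
  have W[measurable]: "W k \<in> borel_measurable M" if "k \<ge> 1" for k
    using ind that by (auto simp: indep_vars_def)
  have nu[measurable]: "\<nu> \<in> measurable M ?C"
    using gs by (auto simp: geometric_sum_def)
  have S[measurable]: "S \<in> measurable M ?P"
    unfolding S_def by (rule measurable_restrict) auto
  have Phi[measurable]: "\<Phi> \<in> measurable M (?C \<Otimes>\<^sub>M ?P)"
    unfolding \<Phi>_def by measurable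
  have sets': "sets M' = sets (?C \<Otimes>\<^sub>M ?P)" and space': "space M' = space (?C \<Otimes>\<^sub>M ?P)"
    by (simp_all add: M'_def)
  have W'_pre: "W' k \<in> borel_measurable (?C \<Otimes>\<^sub>M ?P)" if "k \<ge> 1" for k
    unfolding W'_def using that
    by (intro measurable_compose[OF measurable_snd] measurable_component_singleton) auto
  have W': "W' k \<in> borel_measurable M'" if "k \<ge> 1" for k
    using W'_pre[OF that] by (simp add: M'_def)
  have W'\<Phi>: "W' k (\<Phi> \<omega>) = W k \<omega>" if "k \<ge> 1" for k \<omega>
    using that by (simp add: W'_def \<Phi>_def S_def)
  interpret M': prob_space M'
    unfolding M'_def by (rule prob_space_distr) (rule Phi)
  have snd': "snd \<in> measurable M' ?P" and fst': "fst \<in> measurable M' ?C"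
    by (simp_all add: M'_def)
  have S': "(\<lambda>x. \<lambda>k\<in>{1..}. W' k x) \<in> measurable M' ?P"
    by (rule measurable_restrict) (use W' in auto)
  have S'\<Phi>: "(\<lambda>k\<in>{1..}. W' k (\<Phi> \<omega>)) = S \<omega>" for \<omega>
    by (auto simp: S_def W'\<Phi> intro!: restrict_ext)
  have law': "distr M' borel (W' k) = distr M borel (W k)" if "k \<ge> 1" for k
    unfolding M'_def using that
    by (subst distr_distr[OF W'_pre[OF that] Phi]) (simp add: o_def W'\<Phi>)
  have ind': "M'.indep_vars (\<lambda>_. borel) W' {1..}"
  proof (subst M'.indep_vars_iff_distr_eq_PiM')
    have "distr M' ?P (\<lambda>x. \<lambda>k\<in>{1..}. W' k x) = distr M ?P S"
      unfolding M'_def using S'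
      by (subst distr_distr) (auto simp: o_def S'\<Phi> M'_def Phi)
    also have "\<dots> = PiM {1..} (\<lambda>k. distr M borel (W k))"
      unfolding S_def using indep_vars_iff_distr_eq_PiM'[of "{1..}" W "\<lambda>_. borel"] ind W by auto
    also have "\<dots> = PiM {1..} (\<lambda>k. distr M' borel (W' k))"
      by (intro PiM_cong) (auto simp: law')
    finally show "distr M' ?P (\<lambda>x. \<lambda>k\<in>{1..}. W' k x) = PiM {1..} (\<lambda>k. distr M' borel (W' k))" .
  qed (use W' in auto)
  have iid': "iid_nonneg M' W' G"
    unfolding iid_nonneg_def
  proof (intro conjI allI impI ind')
    fix k :: nat assume k: "1 \<le> k"
    show "distr M' borel (W' k) = G" using law'[OF k] lawW[OF k] by simp
    have "{x \<in> space (?C \<Otimes>\<^sub>M ?P). 0 \<le> W' k x} \<in> sets (?C \<Otimes>\<^sub>M ?P)"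
      using W'_pre[OF k] by measurable
    then show "AE x in M'. 0 \<le> W' k x"
      unfolding M'_def using nonneg[OF k] by (subst AE_distr_iff) (auto simp: W'\<Phi> k Phi)
  qed
  have meas': "M'.prob A = prob (\<Phi> -` A \<inter> space M)" if "A \<in> sets M'" for A
    using that unfolding M'_def by (subst measure_distr) (auto simp: Phi)
  have Phi_space: "\<Phi> \<omega> \<in> space M'" if "\<omega> \<in> space M" for \<omega>
    using measurable_space[OF Phi that] by (simp add: M'_def)
  have indep: "indep_set {\<nu> -` A \<inter> space M | A. A \<in> sets ?C} {S -` B \<inter> space M | B. B \<in> sets ?P}"
    using gs unfolding geometric_sum_def S_def by auto
  have indep': "M'.indep_set {fst -` A \<inter> space M' | A. A \<in> sets ?C}
      {(\<lambda>x. \<lambda>k\<in>{1..}. W' k x) -` B \<inter> space M' | B. B \<in> sets ?P}"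
    unfolding M'.indep_sets2_eq
  proof (intro conjI ballI)
    show "{fst -` A \<inter> space M' | A. A \<in> sets ?C} \<subseteq> sets M'"
      using measurable_sets[OF fst'] by blast
    show "{(\<lambda>x. \<lambda>k\<in>{1..}. W' k x) -` B \<inter> space M' | B. B \<in> sets ?P} \<subseteq> sets M'"
      using measurable_sets[OF S'] by blast
    fix a b
    assume "a \<in> {fst -` A \<inter> space M' | A. A \<in> sets ?C}"
      and "b \<in> {(\<lambda>x. \<lambda>k\<in>{1..}. W' k x) -` B \<inter> space M' | B. B \<in> sets ?P}"
    then obtain A B where A: "A \<in> sets ?C" and a: "a = fst -` A \<inter> space M'"
      and B: "B \<in> sets ?P" and b: "b = (\<lambda>x. \<lambda>k\<in>{1..}. W' k x) -` B \<inter> space M'"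
      by blast
    have am: "a \<in> sets M'" unfolding a by (rule measurable_sets[OF fst' A])
    have bm: "b \<in> sets M'" unfolding b by (rule measurable_sets[OF S' B])
    have pa: "\<Phi> -` a \<inter> space M = \<nu> -` A \<inter> space M"
      using Phi_space by (auto simp: a \<Phi>_def)
    have pb: "\<Phi> -` b \<inter> space M = S -` B \<inter> space M"
      unfolding b by (intro set_eqI iffI) (simp_all add: S'\<Phi> Phi_space)
    have pab: "\<Phi> -` (a \<inter> b) \<inter> space M = (\<nu> -` A \<inter> space M) \<inter> (S -` B \<inter> space M)"
      using pa pb by blast
    have "prob ((\<nu> -` A \<inter> space M) \<inter> (S -` B \<inter> space M))
        = prob (\<nu> -` A \<inter> space M) * prob (S -` B \<inter> space M)"
      using indep A B unfolding indep_sets2_eq by blast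
    then show "M'.prob (a \<inter> b) = M'.prob a * M'.prob b"
      using am bm by (simp only: meas' sets.Int pa pb pab)
  qed
  have geo': "M'.prob {x \<in> space M'. fst x = k} = (1 - 1 / r) ^ (k - 1) * (1 / r)" if "k \<ge> 1" for k
  proof -
    have "{x \<in> space M'. fst x = k} = fst -` {k} \<inter> space M'"
      by auto
    moreover have "fst -` {k} \<inter> space M' \<in> sets M'"
      by (rule measurable_sets[OF fst']) simp
    moreover have "\<Phi> -` (fst -` {k} \<inter> space M') \<inter> space M = {\<omega> \<in> space M. \<nu> \<omega> = k}"
      using Phi_space by (auto simp: \<Phi>_def)
    ultimately show ?thesis
      using gs that by (simp add: meas' geometric_sum_def)
  qed
  have sum_meas: "(\<lambda>x. \<Sum>k=1..fst x. W' k x) \<in> borel_measurable (?C \<Otimes>\<^sub>M ?P)"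
  proof (rule measurable_compose_countable[where f = "\<lambda>n x. \<Sum>k=1..n. W' k x"])
    show "(\<lambda>x. \<Sum>k=1..n. W' k x) \<in> borel_measurable (?C \<Otimes>\<^sub>M ?P)" for n
      using W'_pre by (intro borel_measurable_sum) auto
  qed simp
  have "distr M' borel (\<lambda>x. \<Sum>k=1..fst x. W' k x) = distr M borel (\<lambda>\<omega>. \<Sum>k=1..\<nu> \<omega>. W k \<omega>)"
    unfolding M'_def
    by (subst distr_distr[OF sum_meas Phi], rule distr_cong)
       (auto simp: W'\<Phi> o_def, simp add: \<Phi>_def)
  also have "\<dots> = F"
    using gs by (simp add: geometric_sum_def)
  finally have "geometric_sum M' fst W' (1 / r) F"
    unfolding geometric_sum_def
    using iid' indep' geo' fst' M'.prob_space_axioms by blast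
  with \<open>1 < r\<close> show ?thesis
    unfolding GD_def by blast
qed

end

theory Submission
  imports Defs
begin

text \<open>
  Conditioning on \<open>T\<^sub>1\<close> shows that the mean \<open>E\<close> satisfies the renewal equation \<open>E = 1 - F - E * F\<close> on
  \<open>[0, \<infinity>)\<close>, where \<open>(E * F)(t)\<close> is the integral of \<open>E (t - s)\<close> over \<open>s \<le> t\<close> with respect to \<open>F\<close>. A
  geometric sum with parameter \<open>1 / 2\<close> and summand law \<open>G\<close> satisfies \<open>2 F = G + F * G\<close>, which says that
  \<open>1 - G\<close> solves the same equation. Both equations have unique solutions, so \<open>F \<in> GD 2\<close> holds iff
  \<open>1 - E\<close> is a distribution function. Right-continuity of \<open>1 - E\<close> is automatic; and if \<open>E\<close> is
  monotone and non-negative, its limit \<open>c\<close> at infinity satisfies \<open>c = 1 - 1 - c\<close>, so \<open>c = 0\<close>.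
\<close>

subsection \<open>Convolution powers\<close>

text \<open>Law of a sum of \<open>n\<close> independent variables with law \<open>F\<close>; the
  empty sum is the constant 0.\<close>

primrec conv_pow :: "real measure \<Rightarrow> nat \<Rightarrow> real measure" where
  "conv_pow F 0 = return borel 0"
| "conv_pow F (Suc n) = (F \<star> conv_pow F n)"

lemma real_distribution_convolution:
  assumes "real_distribution F" "real_distribution G"
  shows "real_distribution (F \<star> G)"
proof -
  interpret F: real_distribution F by fact
  interpret G: real_distribution G by fact
  interpret P: pair_prob_space F G ..
  show ?thesis
    unfolding convolution_def by (rule P.real_distribution_distr) measurable
qed

lemma (in real_distribution) borel_measurable_cdf [measurable]:
  "cdf M \<in> borel_measurable borel"
  by (intro borel_measurable_mono monoI cdf_nondecreasing)

lemma (in real_distribution) integrable_cdf_diff: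
  assumes "real_distribution G"
  shows "integrable M (\<lambda>s. cdf G (t - s))"
proof -
  interpret G: real_distribution G by fact
  have [measurable]: "(\<lambda>s. cdf G (t - s)) \<in> borel_measurable M"
    by measurable
  show ?thesis
    by (rule integrable_const_bound[of _ 1]) (auto simp: G.cdf_nonneg G.cdf_bounded_prob)
qed

text \<open>Fubini: once the summand \<open>s\<close> with law \<open>F\<close> is fixed, the sum is
  at most \<open>t\<close> exactly when the other summand lies in \<open>{..t - s}\<close>.\<close>

lemma cdf_convolution:
  assumes "real_distribution F" "real_distribution G"
  shows "cdf (F \<star> G) t = (\<integral>s. cdf G (t - s) \<partial>F)"
proof -
  interpret F: real_distribution F by fact
  interpret G: real_distribution G by fact
  interpret C: real_distribution "F \<star> G"
    by (rule real_distribution_convolution) fact+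
  have set_eq: "{a. a + s \<le> t} = {..t - s}" for s :: real
    by auto
  have "ennreal (cdf (F \<star> G) t) = emeasure (F \<star> G) {..t}"
    by (simp add: cdf_def C.emeasure_eq_measure)
  also have "\<dots> = (\<integral>\<^sup>+s. ennreal (cdf G (t - s)) \<partial>F)"
    by (subst convolution_emeasure)
       (auto simp: set_eq cdf_def G.emeasure_eq_measure F.finite_measure_axioms G.finite_measure_axioms)
  also have "\<dots> = ennreal (\<integral>s. cdf G (t - s) \<partial>F)"
    by (intro nn_integral_eq_integral F.integrable_cdf_diff assms) (simp add: G.cdf_nonneg)
  finally show ?thesis
    by (simp add: C.cdf_nonneg G.cdf_nonneg Bochner_Integration.integral_nonneg)
qed

lemma real_distribution_return: "real_distribution (return borel x)"
  by (simp add: real_distribution_def real_distribution_axioms_def prob_space_return)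

lemma real_distribution_conv_pow:
  "real_distribution F \<Longrightarrow> real_distribution (conv_pow F n)"
  by (induction n) (simp_all add: real_distribution_return real_distribution_convolution)

lemma conv_pow_1:
  assumes "real_distribution F"
  shows "conv_pow F 1 = F"
proof (rule cdf_unique)
  interpret F: real_distribution F by fact
  show "cdf (conv_pow F 1) = cdf F"
  proof
    fix t
    have *: "cdf (return borel 0) (t - s) = indicator {..t} s" for s :: real
      by (simp add: cdf_def measure_return indicator_def)
    have "cdf (conv_pow F 1) t = (\<integral>s. cdf (return borel 0) (t - s) \<partial>F)"
      using assms by (simp add: cdf_convolution real_distribution_return)
    also have "\<dots> = cdf F t"
      unfolding * using F.space_eq_univ by (simp add: cdf_def)
    finally show "cdf (conv_pow F 1) t = cdf F t" .
  qed
qed (rule real_distribution_conv_pow assms)+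

section \<open>Sums of independent identically distributed variables\<close>

lemma (in prob_space) distr_sum_iid:
  assumes ind: "indep_vars (\<lambda>_. borel) T {1..}"
    and law: "\<And>k. k \<ge> 1 \<Longrightarrow> distr M borel (T k) = F"
  shows "distr M borel (\<lambda>\<omega>. \<Sum>k=1..n. T k \<omega>) = conv_pow F n"
proof (induction n)
  case 0
  have "distr M borel (\<lambda>_. 0 :: real) = return borel 0"
    by (rule distr_const) auto
  then show ?case by simp
next
  case (Suc n)
  have T: "random_variable borel (T k)" if "k \<ge> 1" for k
    using ind that by (auto simp: indep_vars_def)
  note One_nat_def [simp del]
  \<comment> \<open>Independence of the newest summand from the sum of its predecessors turns
    addition into convolution; the newest one stands first to match the recursion of
    \<open>conv_pow\<close>.\<close>
  have "indep_var borel (T (Suc n)) borel (\<lambda>\<omega>. \<Sum>k\<in>{1..n}. T k \<omega>)"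
    by (rule indep_vars_sum) (auto intro: indep_vars_subset[OF ind])
  then have "distr M borel (\<lambda>\<omega>. T (Suc n) \<omega> + (\<Sum>k\<in>{1..n}. T k \<omega>)) =
      (distr M borel (T (Suc n)) \<star> distr M borel (\<lambda>\<omega>. \<Sum>k\<in>{1..n}. T k \<omega>))"
    by (rule sum_indep_random_variable) (intro T borel_measurable_sum, simp)+
  moreover have "(\<lambda>\<omega>. \<Sum>k=1..Suc n. T k \<omega>) = (\<lambda>\<omega>. T (Suc n) \<omega> + (\<Sum>k\<in>{1..n}. T k \<omega>))"
    by (simp add: add.commute)
  moreover have "distr M borel (T (Suc n)) = F"
    by (rule law) simp
  ultimately show ?case
    by (simp add: Suc.IH)
qed

lemma (in prob_space) prob_sum_iid_le:
  assumes ind: "indep_vars (\<lambda>_. borel) T {1..}"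
    and law: "\<And>k. k \<ge> 1 \<Longrightarrow> distr M borel (T k) = F"
  shows "prob {\<omega> \<in> space M. (\<Sum>k=1..n. T k \<omega>) \<le> t} = cdf (conv_pow F n) t"
proof -
  have "random_variable borel (T k)" if "k \<ge> 1" for k
    using ind that by (auto simp: indep_vars_def)
  then have "random_variable borel (\<lambda>\<omega>. \<Sum>k=1..n. T k \<omega>)"
    by (intro borel_measurable_sum) simp
  then have "cdf (distr M borel (\<lambda>\<omega>. \<Sum>k=1..n. T k \<omega>)) t =
      prob {\<omega> \<in> space M. (\<Sum>k=1..n. T k \<omega>) \<le> t}"
    unfolding cdf_def by (subst measure_distr) (auto intro!: arg_cong[where f = prob])
  then show ?thesis
    by (simp only: distr_sum_iid[OF ind law])
qed

subsection \<open>The renewal equation of the mean of the switch process\<close>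

text \<open>Increments of the sequence \<open>(- 1) ^ n\<close>: the value 1 at
  \<open>n = 0\<close>, then \<open>(- 1) ^ n - (- 1) ^ (n - 1)\<close>.\<close>

definition switch_coeff :: "nat \<Rightarrow> real" where
  "switch_coeff n = (if n = 0 then 1 else 2) * (- 1) ^ n"

lemma switch_coeff_0 [simp]: "switch_coeff 0 = 1"
  by (simp add: switch_coeff_def)

text \<open>After an index shift, neighbouring coefficients cancel; the pair at 0 alone survives and
  produces the term \<open>- cdf F t\<close> of the renewal equation.\<close>

lemma switch_coeff_add_Suc: "switch_coeff n + switch_coeff (Suc n) = (if n = 0 then - 1 else 0)"
  by (simp add: switch_coeff_def)

lemma abs_switch_coeff_le: "\<bar>switch_coeff n\<bar> \<le> 2"
  by (simp add: switch_coeff_def abs_mult power_abs)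

lemma abs_switch_coeff_le_Suc: "\<bar>switch_coeff n\<bar> \<le> \<bar>switch_coeff (Suc n)\<bar>"
  by (simp add: switch_coeff_def abs_mult power_abs)

lemma sum_switch_coeff: "(\<Sum>n\<le>N. switch_coeff n) = (- 1) ^ N"
  by (induction N) (simp_all add: switch_coeff_def)

section \<open>The Laplace transform at 1 and exponential bounds\<close>

locale positive_distribution = real_distribution F for F :: "real measure" +
  assumes AE_pos: "AE s in F. 0 < s"
begin

definition laplace1 :: real where
  "laplace1 = (\<integral>s. exp (- s) \<partial>F)"

lemma integrable_exp: "integrable F (\<lambda>s. exp (- s))"
proof (rule integrable_const_bound[of _ 1])
  show "AE s in F. norm (exp (- s)) \<le> 1"
    using AE_pos by eventually_elim simp
qed measurable

lemma laplace1_nonneg: "0 \<le> laplace1"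
  unfolding laplace1_def by (rule Bochner_Integration.integral_nonneg) simp

text \<open>The function \<open>1 - exp (- s)\<close> is almost surely positive, so its integral
  \<open>1 - laplace1\<close> cannot be zero.\<close>

lemma laplace1_less_1: "laplace1 < 1"
proof (rule ccontr)
  assume "\<not> laplace1 < 1"
  have int: "integrable F (\<lambda>s. 1 - exp (- s))"
    using integrable_exp by simp
  have nonneg: "AE s in F. 0 \<le> 1 - exp (- s)"
    using AE_pos by eventually_elim simp
  have "(\<integral>s. 1 - exp (- s) \<partial>F) = 1 - laplace1"
    unfolding laplace1_def using integrable_exp prob_space by simp
  with \<open>\<not> laplace1 < 1\<close> have "(\<integral>s. 1 - exp (- s) \<partial>F) = 0"
    using integral_nonneg_AE[OF nonneg] by simp
  then have "AE s in F. 1 - exp (- s) = 0"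
    using integral_nonneg_eq_0_iff_AE[OF int nonneg] by simp
  with AE_pos have "AE s in F. False"
    by eventually_elim simp
  then show False
    by simp
qed

text \<open>An exponential Markov bound: each convolution integrates \<open>exp (t - s)\<close> and
  so contributes one factor \<open>laplace1\<close>. The geometric decay in \<open>n\<close> makes
  the series below converge and rules out infinitely many switches in finite time.\<close>

lemma cdf_conv_pow_le: "cdf (conv_pow F n) t \<le> laplace1 ^ n * exp t"
proof (induction n arbitrary: t)
  case 0
  show ?case by (simp add: cdf_def measure_return indicator_def)
next
  case (Suc n)
  have rd: "real_distribution (conv_pow F n)"
    by (rule real_distribution_conv_pow) (rule real_distribution_axioms)
  have "cdf (conv_pow F (Suc n)) t = (\<integral>s. cdf (conv_pow F n) (t - s) \<partial>F)"
    by (simp add: cdf_convolution real_distribution_axioms rd)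
  also have "\<dots> \<le> (\<integral>s. laplace1 ^ n * exp t * exp (- s) \<partial>F)"
  proof (rule integral_mono)
    show "integrable F (\<lambda>s. cdf (conv_pow F n) (t - s))"
      by (rule integrable_cdf_diff[OF rd])
    show "integrable F (\<lambda>s. laplace1 ^ n * exp t * exp (- s))"
      using integrable_exp by simp
    show "cdf (conv_pow F n) (t - s) \<le> laplace1 ^ n * exp t * exp (- s)" for s
      using Suc.IH[of "t - s"] by (simp add: exp_diff exp_minus field_simps)
  qed
  also have "\<dots> = laplace1 ^ Suc n * exp t"
    by (simp add: laplace1_def)
  finally show ?case .
qed

lemma cdf_conv_pow_eq_0:
  assumes "t < 0"
  shows "cdf (conv_pow F n) t = 0"
  using assms
proof (induction n arbitrary: t)
  case 0
  then show ?case by (simp add: cdf_def measure_return)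
next
  case (Suc n)
  have rd: "real_distribution (conv_pow F n)"
    by (rule real_distribution_conv_pow) (rule real_distribution_axioms)
  have [measurable]: "cdf (conv_pow F n) \<in> borel_measurable borel"
    using rd by (rule real_distribution.borel_measurable_cdf)
  have "AE s in F. cdf (conv_pow F n) (t - s) = 0"
    using AE_pos by eventually_elim (use Suc in simp)
  then have "(\<integral>s. cdf (conv_pow F n) (t - s) \<partial>F) = (\<integral>s. 0 \<partial>F)"
    by (intro integral_cong_AE) measurable
  then show ?case
    by (simp add: cdf_convolution real_distribution_axioms rd)
qed

text \<open>Convolution with \<open>F\<close> is a contraction for the norm \<open>sup |D t| * exp (- t)\<close>.\<close>

lemma renewal_equation_unique:
  assumes meas [measurable]: "D \<in> borel_measurable borel"
    and bound: "\<And>t. \<bar>D t\<bar> \<le> C * exp t"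
    and eq: "\<And>t. D t = - (\<integral>s. D (t - s) \<partial>F)"
  shows "D t = 0"
proof -
  have iter: "\<bar>D t\<bar> \<le> laplace1 ^ n * C * exp t" for n t
  proof (induction n arbitrary: t)
    case 0
    show ?case using bound by simp
  next
    case (Suc n)
    have "\<bar>D t\<bar> = norm (\<integral>s. D (t - s) \<partial>F)"
      by (subst eq) simp
    also have "\<dots> \<le> (\<integral>s. laplace1 ^ n * C * exp t * exp (- s) \<partial>F)"
    proof (rule Bochner_Integration.integral_norm_bound_integral)
      show le: "norm (D (t - s)) \<le> laplace1 ^ n * C * exp t * exp (- s)" for s
        using Suc.IH[of "t - s"] by (simp add: exp_diff exp_minus field_simps)
      show int: "integrable F (\<lambda>s. laplace1 ^ n * C * exp t * exp (- s))"
        using integrable_exp by simp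
      show "integrable F (\<lambda>s. D (t - s))"
        by (rule Bochner_Integration.integrable_bound[OF int])
           (auto intro!: AE_I2 order_trans[OF le[unfolded real_norm_def]])
    qed
    also have "\<dots> = laplace1 ^ Suc n * C * exp t"
      by (simp add: laplace1_def)
    finally show ?case .
  qed
  have "(\<lambda>n. laplace1 ^ n * C * exp t) \<longlonglongrightarrow> 0 * C * exp t"
    by (intro tendsto_intros LIMSEQ_power_zero) (use laplace1_nonneg laplace1_less_1 in simp)
  then have "\<bar>D t\<bar> \<le> 0 * C * exp t"
    by (rule LIMSEQ_le_const) (use iter in blast)
  then show ?thesis by simp
qed


text \<open>
  As \<open>(- 1) ^ N\<close> is the sum of the first \<open>N + 1\<close> coefficients, this is the series
  for the mean of the switch process at a time \<open>t \<ge> 0\<close>.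
\<close>

definition switch_mean :: "real \<Rightarrow> real" where
  "switch_mean t = (\<Sum>n. switch_coeff n * cdf (conv_pow F n) t)"

lemma conv_pow: "real_distribution (conv_pow F n)"
  by (rule real_distribution_conv_pow) (rule real_distribution_axioms)

lemma cdf_conv_pow_nonneg: "0 \<le> cdf (conv_pow F n) t"
  by (simp add: cdf_def)

lemma cdf_conv_pow_Suc: "cdf (conv_pow F (Suc n)) t = (\<integral>s. cdf (conv_pow F n) (t - s) \<partial>F)"
  by (simp add: cdf_convolution real_distribution_axioms conv_pow)

lemma borel_measurable_cdf_conv_pow [measurable]: "cdf (conv_pow F n) \<in> borel_measurable borel"
  by (rule real_distribution.borel_measurable_cdf[OF conv_pow])

lemma norm_switch_term_le:
  "norm (switch_coeff n * cdf (conv_pow F n) t) \<le> 2 * laplace1 ^ n * exp t"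
proof -
  have "\<bar>switch_coeff n\<bar> * cdf (conv_pow F n) t \<le> 2 * (laplace1 ^ n * exp t)"
    by (rule mult_mono) (simp_all add: abs_switch_coeff_le cdf_conv_pow_le cdf_conv_pow_nonneg)
  then show ?thesis
    by (simp add: abs_mult cdf_conv_pow_nonneg mult_ac)
qed

lemma summable_laplace1: "summable (\<lambda>n. 2 * laplace1 ^ n * exp t)"
  using laplace1_nonneg laplace1_less_1
  by (intro summable_mult summable_mult2 summable_geometric) simp

lemma summable_norm_switch_mean: "summable (\<lambda>n. norm (switch_coeff n * cdf (conv_pow F n) t))"
  by (rule summable_norm_comparison_test[OF _ summable_laplace1]) (use norm_switch_term_le in blast)

lemma sums_switch_mean: "(\<lambda>n. switch_coeff n * cdf (conv_pow F n) t) sums switch_mean t"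
  unfolding switch_mean_def
  by (rule summable_sums) (rule summable_norm_cancel[OF summable_norm_switch_mean])

lemma borel_measurable_switch_mean [measurable]: "switch_mean \<in> borel_measurable borel"
  unfolding switch_mean_def[abs_def] by measurable

text \<open>Sums the geometric majorants of the terms; exponential growth is the class in which
  \<open>renewal_equation_unique\<close> applies.\<close>

lemma abs_switch_mean_le: "\<bar>switch_mean t\<bar> \<le> 2 / (1 - laplace1) * exp t"
proof -
  have "\<bar>switch_mean t\<bar> \<le> (\<Sum>n. norm (switch_coeff n * cdf (conv_pow F n) t))"
    unfolding switch_mean_def using summable_norm[OF summable_norm_switch_mean] by simp
  also have "\<dots> \<le> (\<Sum>n. 2 * laplace1 ^ n * exp t)"
    by (intro suminf_le norm_switch_term_le summable_norm_switch_mean summable_laplace1)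
  also have "\<dots> = 2 / (1 - laplace1) * exp t"
    using geometric_sums[of laplace1] laplace1_nonneg laplace1_less_1
    by (intro sums_unique[symmetric]) (auto dest: sums_mult[of _ _ "2 * exp t"] simp: mult_ac)
  finally show ?thesis .
qed

lemma switch_mean_neg: "t < 0 \<Longrightarrow> switch_mean t = 0"
  by (simp add: switch_mean_def cdf_conv_pow_eq_0)

text \<open>Dominated convergence for series: each term is right-continuous, and just to the right
  of \<open>a\<close> the terms have a common summable majorant.\<close>

lemma switch_mean_right_cont: "continuous (at_right a) switch_mean"
  unfolding continuous_within switch_mean_def[abs_def]
proof (rule tannerys_theorem[THEN conjunct2, THEN conjunct2])
  show "((\<lambda>t. switch_coeff k * cdf (conv_pow F k) t) \<longlongrightarrow>
      switch_coeff k * cdf (conv_pow F k) a) (at_right a)" for k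
    using real_distribution.finite_borel_measure_M[OF conv_pow, THEN finite_borel_measure.cdf_is_right_cont]
    by (intro tendsto_mult tendsto_const) (auto simp: continuous_within)
  show "\<forall>\<^sub>F (k, t) in sequentially \<times>\<^sub>F at_right a.
      norm (switch_coeff k * cdf (conv_pow F k) t) \<le> 2 * laplace1 ^ k * exp (a + 1)"
  \<comment> \<open>A limit from the right at \<open>a\<close> only involves
    \<open>t < a + 1\<close>; there \<open>exp t\<close> is at most \<open>exp (a + 1)\<close>,
    which frees the majorant from \<open>t\<close>.\<close>
  proof -
    have "\<forall>\<^sub>F t in at_right a. t < a + 1"
      by (rule order_tendstoD(2)[OF tendsto_ident_at]) simp
    then have "\<forall>\<^sub>F (k, t) in (sequentially :: nat filter) \<times>\<^sub>F at_right a. t < a + 1"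
      by (subst eventually_prod2) simp_all
    then show ?thesis
    proof (rule eventually_mono, clarify)
      fix k t assume "t < a + 1"
      then have "2 * laplace1 ^ k * exp t \<le> 2 * laplace1 ^ k * exp (a + 1)"
        using laplace1_nonneg by (intro mult_left_mono) auto
      with norm_switch_term_le[of k t]
      show "norm (switch_coeff k * cdf (conv_pow F k) t) \<le> 2 * laplace1 ^ k * exp (a + 1)"
        by (rule order_trans)
    qed
  qed
qed (use summable_laplace1 in auto)

text \<open>Integrating the series term by term against \<open>F\<close> turns each convolution
  power into the next one. When the shifted and the original series are added, everything cancels
  except the unit step at \<open>n = 0\<close> and the first power \<open>F\<close>.\<close>

lemma switch_mean_renewal:
  "switch_mean t = indicator {0..} t - cdf F t - (\<integral>s. switch_mean (t - s) \<partial>F)"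
proof -
  let ?a = "\<lambda>n. cdf (conv_pow F n)"
  have int: "integrable F (\<lambda>s. switch_coeff n * ?a n (t - s))" for n
    using integrable_cdf_diff[OF conv_pow] by simp
  have "(\<lambda>n. \<integral>s. switch_coeff n * ?a n (t - s) \<partial>F) sums (\<integral>s. switch_mean (t - s) \<partial>F)"
    unfolding switch_mean_def
  proof (rule sums_integral[OF int])
    show "AE s in F. summable (\<lambda>n. norm (switch_coeff n * ?a n (t - s)))"
      using summable_norm_switch_mean by simp
    have "(\<integral>s. norm (switch_coeff n * ?a n (t - s)) \<partial>F) = \<bar>switch_coeff n\<bar> * ?a (Suc n) t" for n
      unfolding cdf_conv_pow_Suc by (simp add: abs_mult cdf_conv_pow_nonneg del: conv_pow.simps)
    \<comment> \<open>The coefficients do not decrease in absolute value, so the shifted terms are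
      dominated by a tail of the absolutely convergent series.\<close>
    moreover have "\<bar>switch_coeff n\<bar> * ?a (Suc n) t \<le> norm (switch_coeff (Suc n) * ?a (Suc n) t)" for n
      using mult_right_mono[OF abs_switch_coeff_le_Suc cdf_conv_pow_nonneg[of "Suc n" t]]
      by (simp add: abs_mult cdf_conv_pow_nonneg del: conv_pow.simps)
    moreover have "summable (\<lambda>n. norm (switch_coeff (Suc n) * ?a (Suc n) t))"
      using summable_norm_switch_mean[of t] by (subst summable_Suc_iff)
    ultimately show "summable (\<lambda>n. \<integral>s. norm (switch_coeff n * ?a n (t - s)) \<partial>F)"
      by (simp only:) (rule summable_comparison_test'[where N = 0],
        auto simp: abs_mult cdf_conv_pow_nonneg simp del: conv_pow.simps)
  qed
  then have 1: "(\<lambda>n. switch_coeff n * ?a (Suc n) t) sums (\<integral>s. switch_mean (t - s) \<partial>F)"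
    unfolding cdf_conv_pow_Suc by simp
  have "(\<lambda>n. switch_coeff (Suc n) * ?a (Suc n) t) sums (switch_mean t - switch_coeff 0 * ?a 0 t)"
    using sums_switch_mean[of t] by (subst sums_Suc_iff) simp
  from sums_add[OF this 1]
  have "(\<lambda>n. if n = 0 then - ?a (Suc n) t else 0) sums
      (switch_mean t - switch_coeff 0 * ?a 0 t + (\<integral>s. switch_mean (t - s) \<partial>F))"
    by (rule sums_cong[THEN iffD1, rotated])
       (simp only: distrib_right[symmetric] add.commute[of "switch_coeff (Suc _)"] switch_coeff_add_Suc, simp)
  moreover have "(\<lambda>n. if n = 0 then - ?a (Suc n) t else 0) sums (- ?a (Suc 0) t)"
    using sums_single[of 0 "\<lambda>n. - ?a (Suc n) t"] by simp
  ultimately have "switch_mean t - ?a 0 t + (\<integral>s. switch_mean (t - s) \<partial>F) = - ?a 1 t"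
    using sums_unique2 by (simp only: One_nat_def switch_coeff_0 mult_1)
  moreover have "?a 0 t = indicator {0..} t"
    by (simp add: cdf_def measure_return indicator_def)
  moreover have "?a 1 t = cdf F t"
    using conv_pow_1[OF real_distribution_axioms] by simp
  ultimately show ?thesis
    by simp
qed

end

section \<open>The mean of the switch process as a series\<close>

lemma random_variable_switch_process:
  assumes T: "\<And>k. k \<ge> 1 \<Longrightarrow> T k \<in> borel_measurable M" and "0 \<le> t"
  shows "switch_process T t \<in> borel_measurable M"
proof -
  define S where "S n \<omega> = (\<Sum>k=1..n. T k \<omega>)" for n \<omega>
  have [measurable]: "S n \<in> borel_measurable M" for n
    unfolding S_def[abs_def] by (intro borel_measurable_sum T) simp
  \<comment> \<open>The value of \<open>Max\<close> on an infinite set is junk, but it is the same for all sample points.\<close>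
  have eq: "switch_count T t = (\<lambda>\<omega>. if S 1 \<omega> \<le> t then
      if \<exists>m. \<forall>n. S n \<omega> \<le> t \<longrightarrow> n \<le> m then LEAST m. \<forall>n. S n \<omega> \<le> t \<longrightarrow> n \<le> m
      else Max (UNIV :: nat set) else 0)"
  proof
    fix \<omega>
    let ?A = "{n. S n \<omega> \<le> t}"
    \<comment> \<open>On natural numbers \<open>Sup\<close> is \<open>Max\<close> for nonempty sets;
      the empty partial sum puts 0 into the set because \<open>0 \<le> t\<close>.\<close>
    have ne: "0 \<in> ?A"
      using \<open>0 \<le> t\<close> by (simp add: S_def)
    have "Sup ?A = Max ?A"
      using ne by (auto simp: Sup_nat_def)
    moreover have "Max ?A = (LEAST m. \<forall>n. S n \<omega> \<le> t \<longrightarrow> n \<le> m)" if "finite ?A"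
    proof (rule Least_equality[symmetric])
      show "\<forall>n. S n \<omega> \<le> t \<longrightarrow> n \<le> Max ?A"
        using that by simp
      have "Max ?A \<in> ?A"
        using that ne by (intro Max_in) auto
      then show "Max ?A \<le> m" if "\<forall>n. S n \<omega> \<le> t \<longrightarrow> n \<le> m" for m
        using that by blast
    qed
    moreover have "Max ?A = Max (UNIV :: nat set)" if "infinite ?A"
      using that by (simp add: Max.infinite)
    moreover have "finite ?A \<longleftrightarrow> (\<exists>m. \<forall>n. S n \<omega> \<le> t \<longrightarrow> n \<le> m)"
      by (simp add: finite_nat_set_iff_bounded_le)
    ultimately show "switch_count T t \<omega> = (if S 1 \<omega> \<le> t then
      if \<exists>m. \<forall>n. S n \<omega> \<le> t \<longrightarrow> n \<le> m then LEAST m. \<forall>n. S n \<omega> \<le> t \<longrightarrow> n \<le> m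
      else Max (UNIV :: nat set) else 0)"
      by (simp add: switch_count_def S_def)
  qed
  have [measurable]: "switch_count T t \<in> measurable M (count_space UNIV)"
    unfolding eq by measurable
  show ?thesis
    unfolding switch_process_def[abs_def] by measurable
qed

text \<open>Almost surely \<open>S n \<omega> \<le> t\<close> holds exactly for
  \<open>n \<le> N\<close>, where \<open>N\<close> is the count. Hence \<open>(- 1) ^ N\<close> is
  the sum of \<open>switch_coeff n\<close> over those \<open>n\<close> with
  \<open>S n \<omega> \<le> t\<close>, and termwise expectation gives the series.\<close>

lemma (in prob_space) expected_value_eq_switch_mean:
  assumes iid: "iid_nonneg M T F" and "positive_distribution F" and "0 \<le> t"
  shows "expected_value M T t = positive_distribution.switch_mean F t"
proof -
  interpret F: positive_distribution F by fact
  define S where "S n \<omega> = (\<Sum>k=1..n. T k \<omega>)" for n \<omega>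
  have ind: "indep_vars (\<lambda>_. borel) T {1..}"
    and law: "\<And>k. k \<ge> 1 \<Longrightarrow> distr M borel (T k) = F"
    using iid by (auto simp: iid_nonneg_def)
  have T: "random_variable borel (T k)" if "k \<ge> 1" for k
    using ind that by (auto simp: indep_vars_def)
  have S [measurable]: "random_variable borel (S n)" for n
    unfolding S_def[abs_def] by (intro borel_measurable_sum T) simp
  have cdf_S: "prob {\<omega> \<in> space M. S n \<omega> \<le> t} = cdf (conv_pow F n) t" for n
    unfolding S_def by (rule prob_sum_iid_le[OF ind law])
  have "AE \<omega> in M. 0 < T k \<omega>" if "k \<ge> 1" for k
    using F.AE_pos law[OF that] T[OF that] by (auto intro: AE_distrD)
  then have pos: "AE \<omega> in M. \<forall>k\<in>{1..}. 0 < T k \<omega>"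
    by (subst AE_ball_countable) auto
  \<comment> \<open>No explosion: partial sums that all stay below \<open>t\<close> imply
    \<open>S n \<omega> \<le> t\<close> for each \<open>n\<close>, and these probabilities have
    geometrically decaying bounds.\<close>
  have "prob {\<omega> \<in> space M. \<forall>n. S n \<omega> \<le> t} \<le> 0 * exp t"
  proof (rule LIMSEQ_le_const)
    show "(\<lambda>n. F.laplace1 ^ n * exp t) \<longlonglongrightarrow> 0 * exp t"
      by (intro tendsto_intros LIMSEQ_power_zero) (use F.laplace1_nonneg F.laplace1_less_1 in simp)
    have "prob {\<omega> \<in> space M. \<forall>n. S n \<omega> \<le> t} \<le> F.laplace1 ^ n * exp t" for n
    proof -
      have "prob {\<omega> \<in> space M. \<forall>n. S n \<omega> \<le> t} \<le> prob {\<omega> \<in> space M. S n \<omega> \<le> t}"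
        by (intro finite_measure_mono) auto
      with F.cdf_conv_pow_le[of n t] show ?thesis
        by (simp add: cdf_S)
    qed
    then show "\<exists>N. \<forall>n\<ge>N. prob {\<omega> \<in> space M. \<forall>n. S n \<omega> \<le> t} \<le> F.laplace1 ^ n * exp t"
      by blast
  qed
  then have "prob {\<omega> \<in> space M. \<forall>n. S n \<omega> \<le> t} = 0"
    by (simp add: measure_le_0_iff)
  moreover have "{\<omega> \<in> space M. \<forall>n. S n \<omega> \<le> t} \<in> events"
    by measurable
  ultimately have unbounded: "AE \<omega> in M. \<exists>n. t < S n \<omega>"
    by (subst (asm) prob_eq_0) (auto simp: not_le)
  let ?f = "\<lambda>n \<omega>. switch_coeff n * indicator {\<omega> \<in> space M. S n \<omega> \<le> t} \<omega>"
  have count: "AE \<omega> in M. \<exists>N. switch_count T t \<omega> = N \<and> (\<forall>n. S n \<omega> \<le> t \<longleftrightarrow> n \<le> N)"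
    using pos unbounded
  proof eventually_elim
    case (elim \<omega>)
    let ?A = "{n. S n \<omega> \<le> t}"
    have mono: "S m \<omega> \<le> S n \<omega>" if "m \<le> n" for m n
      unfolding S_def by (rule sum_mono2) (use that elim(1) in \<open>auto intro: less_imp_le\<close>)
    have ne: "0 \<in> ?A"
      using \<open>0 \<le> t\<close> by (simp add: S_def)
    from elim(2) obtain m where "t < S m \<omega>" by blast
    have "?A \<subseteq> {..m}"
    proof
      fix n assume "n \<in> ?A"
      with \<open>t < S m \<omega>\<close> have "S n \<omega> < S m \<omega>" by simp
      with mono[of m n] show "n \<in> {..m}" by fastforce
    qed
    then have fin: "finite ?A"
      by (rule finite_subset) simp
    have A: "S n \<omega> \<le> t \<longleftrightarrow> n \<le> Max ?A" for n
    proof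
      show "S n \<omega> \<le> t \<Longrightarrow> n \<le> Max ?A"
        using fin by simp
      have "Max ?A \<in> ?A"
        using fin ne by (intro Max_in) auto
      then show "n \<le> Max ?A \<Longrightarrow> S n \<omega> \<le> t"
        using mono[of n "Max ?A"] by simp
    qed
    have T1: "T 1 \<omega> = S 1 \<omega>"
      by (simp add: S_def)
    have Sup_A: "Sup ?A = Max ?A"
      using ne by (auto simp: Sup_nat_def)
    have "switch_count T t \<omega> = Max ?A"
    \<comment> \<open>If the first switch comes after \<open>t\<close>, then \<open>Max ?A\<close>
      is 0, the value given by the \<open>else\<close> branch of
      \<open>switch_count\<close>.\<close>
    proof (cases "1 \<le> Max ?A")
      case True
      then show ?thesis
        unfolding switch_count_def T1 A[of 1] using Sup_A by (simp add: S_def)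
    next
      case False
      then show ?thesis
        unfolding switch_count_def T1 A[of 1] by simp
    qed
    with A show ?case by blast
  qed
  have term_eq: "?f n \<omega> = (if n \<in> {..switch_count T t \<omega>} then switch_coeff n else 0)"
    if "\<omega> \<in> space M" "\<exists>N. switch_count T t \<omega> = N \<and> (\<forall>n. S n \<omega> \<le> t \<longleftrightarrow> n \<le> N)" for n \<omega>
    using that by auto
  have int_term: "(\<integral>\<omega>. ?f n \<omega> \<partial>M) = switch_coeff n * cdf (conv_pow F n) t" for n
    by (simp add: cdf_S)
  \<comment> \<open>Almost surely only finitely many terms are nonzero, and the expected absolute
    values are summable, so sum and expectation may be exchanged.\<close>
  have "(\<integral>\<omega>. (\<Sum>n. ?f n \<omega>) \<partial>M) = (\<Sum>n. \<integral>\<omega>. ?f n \<omega> \<partial>M)"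
  proof (rule integral_suminf)
    show "integrable M (?f n)" for n
      by (intro integrable_mult_right integrable_real_indicator) (auto simp: emeasure_eq_measure)
    show "AE \<omega> in M. summable (\<lambda>n. norm (?f n \<omega>))"
      using count AE_space
    proof eventually_elim
      case (elim \<omega>)
      show ?case
        by (rule summable_finite[of "{..switch_count T t \<omega>}"]) (simp_all only: term_eq[OF elim(2,1)], auto)
    qed
    show "summable (\<lambda>n. \<integral>\<omega>. norm (?f n \<omega>) \<partial>M)"
      using F.summable_norm_switch_mean[of t]
      by (simp add: abs_mult cdf_S F.cdf_conv_pow_nonneg)
  qed
  then have "F.switch_mean t = (\<integral>\<omega>. (\<Sum>n. ?f n \<omega>) \<partial>M)"
    by (simp only: int_term F.switch_mean_def)
  also have "\<dots> = (\<integral>\<omega>. switch_process T t \<omega> \<partial>M)"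
  proof (rule integral_cong_AE)
    show "AE \<omega> in M. (\<Sum>n. ?f n \<omega>) = switch_process T t \<omega>"
      using count AE_space
    proof eventually_elim
      case (elim \<omega>)
      have "(\<lambda>n. ?f n \<omega>) sums (\<Sum>n\<in>{..switch_count T t \<omega>}. switch_coeff n)"
        unfolding term_eq[OF elim(2,1)] by (rule sums_If_finite_set) simp
      then show ?case
        by (simp add: sums_iff sum_switch_coeff switch_process_def)
    qed
    show "switch_process T t \<in> borel_measurable M"
      by (rule random_variable_switch_process) (use T \<open>0 \<le> t\<close> in auto)
  qed measurable
  finally show ?thesis
    by (simp add: expected_value_def)
qed

subsection \<open>Geometric sums\<close>

lemma (in prob_space) distr_pair_snd:
  assumes "prob_space N"
  shows "distr (M \<Otimes>\<^sub>M N) N snd = N"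
proof (rule measure_eqI)
  interpret N: prob_space N by fact
  fix A assume A: "A \<in> sets (distr (M \<Otimes>\<^sub>M N) N snd)"
  then have "snd -` A \<inter> space (M \<Otimes>\<^sub>M N) = space M \<times> A"
    using sets.sets_into_space by (fastforce simp: space_pair_measure)
  then show "emeasure (distr (M \<Otimes>\<^sub>M N) N snd) A = emeasure N A"
    using A by (simp add: emeasure_distr N.emeasure_pair_measure_Times emeasure_space_1)
qed simp

text \<open>Split along the value of \<open>\<nu>\<close>, which is independent of the partial sums.
  Since \<open>\<nu>\<close> starts at 1, the \<open>n\<close>-th term belongs to
  \<open>\<nu> = Suc n\<close>.\<close>

lemma cdf_geometric_sum:
  assumes gs: "geometric_sum M \<nu> W p F" and iid: "iid_nonneg M W G"
    and p: "0 < p" "p \<le> 1"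
  shows "(\<lambda>n. (1 - p) ^ n * p * cdf (conv_pow G (Suc n)) t) sums cdf F t"
proof -
  interpret prob_space M
    using gs by (simp add: geometric_sum_def)
  define S where "S n \<omega> = (\<Sum>k=1..n. W k \<omega>)" for n \<omega>
  let ?P = "\<Pi>\<^sub>M k\<in>{1::nat..}. (borel :: real measure)"
  have ind: "indep_vars (\<lambda>_. borel) W {1..}"
    and law: "\<And>k. k \<ge> 1 \<Longrightarrow> distr M borel (W k) = G"
    using iid by (auto simp: iid_nonneg_def)
  have W: "random_variable borel (W k)" if "k \<ge> 1" for k
    using ind that by (auto simp: indep_vars_def)
  have S [measurable]: "random_variable borel (S n)" for n
    unfolding S_def[abs_def] by (intro borel_measurable_sum W) simp
  have nu [measurable]: "\<nu> \<in> measurable M (count_space UNIV)"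
    and ind_nu: "indep_set {\<nu> -` A \<inter> space M | A. A \<in> sets (count_space UNIV)}
       {(\<lambda>\<omega>. \<lambda>k\<in>{1..}. W k \<omega>) -` B \<inter> space M | B. B \<in> sets ?P}"
    and geo: "\<And>k. k \<ge> 1 \<Longrightarrow> prob {\<omega> \<in> space M. \<nu> \<omega> = k} = (1 - p) ^ (k - 1) * p"
    and F: "F = distr M borel (\<lambda>\<omega>. S (\<nu> \<omega>) \<omega>)"
    using gs by (auto simp: geometric_sum_def S_def)
  have [measurable]: "(\<lambda>\<omega>. S (\<nu> \<omega>) \<omega>) \<in> borel_measurable M"
    by (rule measurable_compose_countable[OF S nu])
  have cdf_S: "prob {\<omega> \<in> space M. S n \<omega> \<le> t} = cdf (conv_pow G n) t" for n
    unfolding S_def by (rule prob_sum_iid_le[OF ind law])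
  have geo_sums: "(\<lambda>n. (1 - p) ^ n * p) sums 1"
    using sums_mult2[OF geometric_sums[of "1 - p"], of p] p by simp
  have nu_sums: "(\<lambda>n. prob {\<omega> \<in> space M. \<nu> \<omega> = n}) sums 1"
  proof -
    have "(\<lambda>n. prob {\<omega> \<in> space M. \<nu> \<omega> = n}) sums prob (\<Union>n. {\<omega> \<in> space M. \<nu> \<omega> = n})"
      by (rule finite_measure_UNION) (auto simp: disjoint_family_on_def)
    moreover have "(\<Union>n. {\<omega> \<in> space M. \<nu> \<omega> = n}) = space M"
      by auto
    ultimately show ?thesis
      by (simp add: prob_space)
  qed
  \<comment> \<open>The geometric weights are prescribed only from 1 on; as they already add up to
    1, no mass is left at 0.\<close>
  have nu_0: "prob {\<omega> \<in> space M. \<nu> \<omega> = 0} = 0"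
  proof -
    have "(\<lambda>n. prob {\<omega> \<in> space M. \<nu> \<omega> = Suc n}) sums 1"
      using geo_sums by (simp add: geo)
    then have "(\<lambda>n. prob {\<omega> \<in> space M. \<nu> \<omega> = n}) sums (1 + prob {\<omega> \<in> space M. \<nu> \<omega> = 0})"
      by (subst (asm) sums_Suc_iff)
    from sums_unique2[OF this nu_sums] show ?thesis by simp
  qed
  let ?A = "\<lambda>n. {\<omega> \<in> space M. \<nu> \<omega> = n} \<inter> {\<omega> \<in> space M. S n \<omega> \<le> t}"
  have A_sums: "(\<lambda>n. prob (?A n)) sums cdf F t"
  proof -
    have "(\<lambda>n. prob (?A n)) sums prob (\<Union>n. ?A n)"
      by (rule finite_measure_UNION) (auto simp: disjoint_family_on_def)
    moreover have "prob (\<Union>n. ?A n) = cdf F t"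
      unfolding F cdf_def by (subst measure_distr) (auto intro!: arg_cong[where f = prob])
    ultimately show ?thesis by simp
  qed
  have A: "prob (?A n) = prob {\<omega> \<in> space M. \<nu> \<omega> = n} * cdf (conv_pow G n) t" for n
  proof -
    \<comment> \<open>Independence is stated for events of the whole sequence, so the partial-sum
      event is written as a preimage under the sequence map.\<close>
    let ?B = "{x \<in> space ?P. (\<Sum>k=1..n. x k) \<le> t}"
    have "(\<lambda>x. \<Sum>k=1..n. x k) \<in> borel_measurable ?P"
      by (intro borel_measurable_sum measurable_component_singleton) simp
    then have B: "?B \<in> sets ?P"
      by measurable
    have eq: "{\<omega> \<in> space M. S n \<omega> \<le> t} = (\<lambda>\<omega>. \<lambda>k\<in>{1..}. W k \<omega>) -` ?B \<inter> space M"
      by (auto simp: S_def space_PiM)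
    have eq': "{\<omega> \<in> space M. \<nu> \<omega> = n} = \<nu> -` {n} \<inter> space M"
      by auto
    have "{n} \<in> sets (count_space UNIV)"
      by simp
    with ind_nu B have "prob (?A n) = prob {\<omega> \<in> space M. \<nu> \<omega> = n} * prob {\<omega> \<in> space M. S n \<omega> \<le> t}"
      unfolding indep_sets2_eq eq eq' by blast
    then show ?thesis
      by (simp only: cdf_S)
  qed
  have "(\<lambda>n. prob (?A (Suc n))) sums (cdf F t - prob (?A 0))"
    using A_sums by (subst sums_Suc_iff) simp
  then show ?thesis
    unfolding A by (simp add: nu_0 geo del: conv_pow.simps)
qed

text \<open>Memorylessness: with probability \<open>p\<close> the sum stops after its first summand,
  otherwise an independent copy of the whole sum follows. In the series, the term
  \<open>n = 0\<close> gives \<open>p * cdf G t\<close>, and the rest is \<open>1 - p\<close> times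
  the series convolved with \<open>G\<close>.\<close>

lemma geometric_sum_renewal:
  assumes gs: "geometric_sum M \<nu> W p F" and iid: "iid_nonneg M W G" and rd: "real_distribution G"
    and p: "0 < p" "p \<le> 1"
  shows "cdf F t = p * cdf G t + (1 - p) * (\<integral>s. cdf F (t - s) \<partial>G)"
proof -
  interpret G: real_distribution G by fact
  let ?a = "\<lambda>n. cdf (conv_pow G n)"
  note conv = real_distribution_conv_pow[OF rd]
  have a_nonneg: "0 \<le> ?a n x" and a_le: "?a n x \<le> 1" for n x
    using conv by (simp_all add: cdf_def real_distribution.cdf_bounded_prob[unfolded cdf_def])
  have a_Suc: "?a (Suc n) t = (\<integral>s. ?a n (t - s) \<partial>G)" for n
    by (simp add: cdf_convolution rd conv)
  have F: "(\<lambda>n. (1 - p) ^ n * p * ?a (Suc n) x) sums cdf F x" for x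
    by (rule cdf_geometric_sum[OF gs iid p])
  have norm_le: "norm ((1 - p) ^ n * p * ?a m x) \<le> (1 - p) ^ n * p" for n m x
    using p a_nonneg[of m x] a_le[of m x] by (simp add: abs_mult mult_left_le)
  have summable_geo: "summable (\<lambda>n. (1 - p) ^ n * p)"
    using p by (intro summable_mult2 summable_geometric) simp
  have F_eq: "cdf F x = (\<Sum>n. (1 - p) ^ n * p * ?a (Suc n) x)" for x
    using F by (rule sums_unique)
  have int: "integrable G (\<lambda>s. (1 - p) ^ n * p * ?a (Suc n) (t - s))" for n
    using G.integrable_cdf_diff[OF conv] by (simp del: conv_pow.simps)
  have int_eq: "(\<integral>s. (1 - p) ^ n * p * ?a (Suc n) (t - s) \<partial>G) = (1 - p) ^ n * p * ?a (Suc (Suc n)) t" for n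
    unfolding a_Suc[of "Suc n"] by (simp del: conv_pow.simps)
  have "(\<lambda>n. \<integral>s. (1 - p) ^ n * p * ?a (Suc n) (t - s) \<partial>G) sums (\<integral>s. cdf F (t - s) \<partial>G)"
    unfolding F_eq
  proof (rule sums_integral[OF int])
    show "AE s in G. summable (\<lambda>n. norm ((1 - p) ^ n * p * ?a (Suc n) (t - s)))"
      by (intro AE_I2 summable_norm_comparison_test[OF _ summable_geo]) (use norm_le in blast)
    have "norm ((1 - p) ^ n * p * ?a (Suc n) x) = (1 - p) ^ n * p * ?a (Suc n) x" for n x
      using p a_nonneg[of "Suc n" x] by (simp add: abs_mult del: conv_pow.simps)
    then show "summable (\<lambda>n. \<integral>s. norm ((1 - p) ^ n * p * ?a (Suc n) (t - s)) \<partial>G)"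
      unfolding int_eq by (simp only: int_eq)
        (rule summable_comparison_test[OF _ summable_geo], use norm_le in blast)
  qed
  then have "(\<lambda>n. (1 - p) ^ n * p * ?a (Suc (Suc n)) t) sums (\<integral>s. cdf F (t - s) \<partial>G)"
    unfolding int_eq .
  from sums_mult[OF this, of "1 - p"]
  have "(\<lambda>n. (1 - p) ^ Suc n * p * ?a (Suc (Suc n)) t) sums ((1 - p) * (\<integral>s. cdf F (t - s) \<partial>G))"
    by (simp only: power_Suc mult.assoc)
  then have "(\<lambda>n. (1 - p) ^ n * p * ?a (Suc n) t) sums
      ((1 - p) * (\<integral>s. cdf F (t - s) \<partial>G) + (1 - p) ^ 0 * p * ?a (Suc 0) t)"
    by (subst (asm) sums_Suc_iff)
  from sums_unique2[OF this F] show ?thesis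
    using conv_pow_1[OF rd] by simp
qed

text \<open>The difference \<open>D\<close> of two solutions equals \<open>1 - p\<close> times its
  convolution with the probability measure \<open>G\<close>, a contraction in the supremum norm
  because \<open>p\<close> is positive.\<close>

lemma geometric_renewal_unique:
  assumes G: "real_distribution G" and F: "real_distribution F" and F': "real_distribution F'"
    and p: "0 < p" "p \<le> 1"
    and eq: "\<And>t. cdf F t = p * cdf G t + (1 - p) * (\<integral>s. cdf F (t - s) \<partial>G)"
    and eq': "\<And>t. cdf F' t = p * cdf G t + (1 - p) * (\<integral>s. cdf F' (t - s) \<partial>G)"
  shows "F = F'"
proof (rule cdf_unique[OF F F'], rule ext)
  fix t
  interpret G: real_distribution G by fact
  interpret F: real_distribution F by fact
  interpret F': real_distribution F' by fact
  define D where "D x = cdf F x - cdf F' x" for x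
  have int: "integrable G (\<lambda>s. D (x - s))" for x
    unfolding D_def by (intro Bochner_Integration.integrable_diff G.integrable_cdf_diff F F')
  have D: "D x = (1 - p) * (\<integral>s. D (x - s) \<partial>G)" for x
    unfolding D_def using eq[of x] eq'[of x]
    by (subst Bochner_Integration.integral_diff) (auto simp: G.integrable_cdf_diff F F' algebra_simps)
  have iter: "\<bar>D x\<bar> \<le> (1 - p) ^ n" for n x
  proof (induction n arbitrary: x)
    case 0
    show ?case
      using F.cdf_nonneg[of x] F.cdf_bounded_prob[of x] F'.cdf_nonneg[of x] F'.cdf_bounded_prob[of x]
      by (simp add: D_def)
  next
    case (Suc n)
    have "norm (\<integral>s. D (x - s) \<partial>G) \<le> (\<integral>s. (1 - p) ^ n \<partial>G)"
      by (rule Bochner_Integration.integral_norm_bound_integral[OF int]) (use Suc.IH in auto)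
    then have "\<bar>\<integral>s. D (x - s) \<partial>G\<bar> \<le> (1 - p) ^ n"
      using G.prob_space by simp
    then show ?case
      using p by (subst D) (simp add: abs_mult mult_left_mono)
  qed
  have "(\<lambda>n. (1 - p) ^ n) \<longlonglongrightarrow> 0"
    using p by (intro LIMSEQ_power_zero) simp
  then have "\<bar>D t\<bar> \<le> 0"
    by (rule LIMSEQ_le_const) (use iter in blast)
  then show "cdf F t = cdf F' t"
    by (simp add: D_def)
qed

text \<open>The sample space is the product of a geometric law with an infinite product of copies of
  \<open>G\<close>; the variables are read off its coordinates.\<close>

lemma geometric_sum_exists:
  assumes rd: "real_distribution G" and nonneg: "AE s in G. 0 \<le> s" and p: "0 < p" "p \<le> 1"
  obtains M :: "(nat \<times> (nat \<Rightarrow> real)) measure" and \<nu> W F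
  where "iid_nonneg M W G" "geometric_sum M \<nu> W p F"
proof -
  note One_nat_def [simp del]
  interpret G: real_distribution G by fact
  let ?P = "\<Pi>\<^sub>M k\<in>{1::nat..}. G"
  let ?Pb = "\<Pi>\<^sub>M k\<in>{1::nat..}. (borel :: real measure)"
  let ?N = "measure_pmf (geometric_pmf p)"
  define M where "M = ?N \<Otimes>\<^sub>M ?P"
  \<comment> \<open>\<open>geometric_pmf\<close> counts failures from 0 on, hence the
    successor.\<close>
  define \<nu> :: "nat \<times> (nat \<Rightarrow> real) \<Rightarrow> nat" where "\<nu> x = Suc (fst x)" for x
  define W :: "nat \<Rightarrow> nat \<times> (nat \<Rightarrow> real) \<Rightarrow> real" where "W k x = snd x k" for k x
  interpret P: prob_space ?P
    by (rule prob_space_PiM) (rule G.prob_space_axioms)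
  interpret NP: pair_prob_space ?N ?P ..
  interpret M: prob_space M
    unfolding M_def by (rule NP.prob_space_axioms)
  have sets_P: "sets ?P = sets ?Pb"
    by (rule sets_PiM_cong) simp_all
  have fst': "fst \<in> measurable M ?N" and snd': "snd \<in> measurable M ?P"
    by (simp_all add: M_def)
  have snd_Pb: "snd \<in> measurable M ?Pb"
    using snd' by (simp cong: measurable_cong_sets add: sets_P)
  have law_snd: "distr M ?P snd = ?P"
    unfolding M_def by (rule measure_pmf.distr_pair_snd) (rule P.prob_space_axioms)
  have comp: "(\<lambda>x. x k) \<in> measurable ?P G" if "k \<ge> 1" for k
    using that by (intro measurable_component_singleton) simp
  have W: "W k \<in> borel_measurable M" if "k \<ge> 1" for k
    using measurable_compose[OF snd' comp[OF that]] unfolding W_def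
    by (simp cong: measurable_cong_sets)
  \<comment> \<open>Points of the infinite product are extensional functions, so restricting them to
    \<open>{1..}\<close> changes nothing.\<close>
  have restr: "(\<lambda>k\<in>{1..}. W k x) = snd x" if "x \<in> space M" for x
    using that by (auto simp: W_def M_def space_pair_measure space_PiM PiE_def extensional_def)
  have law: "distr M borel (W k) = G" if "k \<ge> 1" for k
  proof -
    have "distr M borel (W k) = distr M G ((\<lambda>x. x k) \<circ> snd)"
      by (rule distr_cong) (auto simp: W_def)
    also have "\<dots> = distr ?P G (\<lambda>x. x k)"
      using distr_distr[OF comp[OF that] snd'] by (simp add: law_snd)
    also have "\<dots> = G"
      by (rule distr_PiM_component) (use that G.prob_space_axioms in auto)
    finally show ?thesis .
  qed
  have ind: "M.indep_vars (\<lambda>_. borel) W {1..}"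
  proof (subst M.indep_vars_iff_distr_eq_PiM')
    have "distr M ?Pb (\<lambda>x. \<lambda>k\<in>{1..}. W k x) = distr M ?P snd"
      by (rule distr_cong) (simp_all add: restr sets_P)
    also have "\<dots> = PiM {1..} (\<lambda>k. distr M borel (W k))"
      unfolding law_snd by (intro PiM_cong) (auto simp: law)
    finally show "distr M ?Pb (\<lambda>x. \<lambda>k\<in>{1..}. W k x) = PiM {1..} (\<lambda>k. distr M borel (W k))" .
  qed (use W in auto)
  have iid: "iid_nonneg M W G"
    unfolding iid_nonneg_def
  proof (intro conjI allI impI ind law)
    fix k :: nat assume k: "1 \<le> k"
    have "AE s in distr M borel (W k). 0 \<le> s"
      unfolding law[OF k] by (rule nonneg)
    then show "AE x in M. 0 \<le> W k x"
      by (rule AE_distrD[OF W[OF k]])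
  qed
  have indep: "M.indep_set {\<nu> -` A \<inter> space M | A. A \<in> sets (count_space UNIV)}
      {(\<lambda>x. \<lambda>k\<in>{1..}. W k x) -` B \<inter> space M | B. B \<in> sets ?Pb}"
    unfolding M.indep_sets2_eq
  proof (intro conjI ballI)
    \<comment> \<open>Events of \<open>\<nu>\<close> and of the sequence are cylinders over the two
      factors, so their intersection is a rectangle, whose measure is a product.\<close>
    have A: "\<exists>A'. \<nu> -` A \<inter> space M = A' \<times> space ?P" for A
      by (rule exI[of _ "Suc -` A"]) (auto simp: \<nu>_def M_def space_pair_measure)
    have B: "(\<lambda>x. \<lambda>k\<in>{1..}. W k x) -` B \<inter> space M = UNIV \<times> B" if "B \<in> sets ?P" for B
    proof -
      have "(\<lambda>x. \<lambda>k\<in>{1..}. W k x) -` B \<inter> space M = snd -` B \<inter> space M"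
        by (auto simp: restr)
      also have "\<dots> = UNIV \<times> B"
        using sets.sets_into_space[OF that] by (auto simp: M_def space_pair_measure)
      finally show ?thesis .
    qed
    show "{\<nu> -` A \<inter> space M | A. A \<in> sets (count_space UNIV)} \<subseteq> sets M"
    proof clarify
      fix A
      obtain A' where "\<nu> -` A \<inter> space M = A' \<times> space ?P" using A by blast
      then show "\<nu> -` A \<inter> space M \<in> sets M" by (simp add: M_def)
    qed
    show "{(\<lambda>x. \<lambda>k\<in>{1..}. W k x) -` B \<inter> space M | B. B \<in> sets ?Pb} \<subseteq> sets M"
      unfolding sets_P[symmetric]
    proof clarify
      fix B' assume B': "B' \<in> sets ?P"
      then show "(\<lambda>x. \<lambda>k\<in>{1..}. W k x) -` B' \<inter> space M \<in> sets M"
        unfolding B[OF B'] by (simp add: M_def)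
    qed
    fix a b
    assume "a \<in> {\<nu> -` A \<inter> space M | A. A \<in> sets (count_space UNIV)}"
      and "b \<in> {(\<lambda>x. \<lambda>k\<in>{1..}. W k x) -` B \<inter> space M | B. B \<in> sets ?Pb}"
    then obtain A0 B where a0: "a = \<nu> -` A0 \<inter> space M" and B': "B \<in> sets ?P"
      and b0: "b = (\<lambda>x. \<lambda>k\<in>{1..}. W k x) -` B \<inter> space M"
      unfolding sets_P[symmetric] by blast
    obtain A' where a: "a = A' \<times> space ?P"
      using A[of A0] a0 by blast
    have b: "b = UNIV \<times> B"
      unfolding b0 by (rule B[OF B'])
    have ab: "a \<inter> b = A' \<times> B"
      using sets.sets_into_space[OF B'] by (auto simp: a b)
    show "M.prob (a \<inter> b) = M.prob a * M.prob b"
      unfolding ab unfolding a b M_def using B'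
      by (simp add: measure_def P.emeasure_pair_measure_Times enn2real_mult P.emeasure_space_1)
  qed
  have nu: "\<nu> \<in> measurable M (count_space UNIV)"
    using measurable_compose[OF fst', of Suc] by (simp add: \<nu>_def[abs_def])
  have geo: "M.prob {x \<in> space M. \<nu> x = k} = (1 - p) ^ (k - 1) * p" if "k \<ge> 1" for k
  proof -
    have "{x \<in> space M. \<nu> x = k} = {k - 1} \<times> space ?P"
      using that by (auto simp: \<nu>_def M_def space_pair_measure)
    then have "M.prob {x \<in> space M. \<nu> x = k} = measure ?N {k - 1}"
      by (simp add: M_def measure_def P.emeasure_pair_measure_Times P.emeasure_space_1)
    then show ?thesis
      using p by (simp add: measure_pmf_single)
  qed
  have "geometric_sum M \<nu> W p (distr M borel (\<lambda>x. \<Sum>k=1..\<nu> x. W k x))"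
    unfolding geometric_sum_def using M.prob_space_axioms iid nu indep geo by blast
  with iid show ?thesis
    by (rule that)
qed

subsection \<open>The equivalence\<close>

text \<open>Both sides are distribution functions of the same convolution. This passes between the
  equation of the mean, with integrals against \<open>F\<close>, and that of a geometric sum, with
  integrals against \<open>G\<close>.\<close>

lemma convolution_commutative_real:
  assumes "real_distribution F" "real_distribution G"
  shows "(\<integral>s. cdf G (t - s) \<partial>F) = (\<integral>s. cdf F (t - s) \<partial>G)"
proof -
  interpret F: real_distribution F by fact
  interpret G: real_distribution G by fact
  have "(F \<star> G) = (G \<star> F)"
    by (rule convolution_commutative) (simp_all add: F.finite_measure_axioms G.finite_measure_axioms)
  then show ?thesis
    by (simp add: cdf_convolution[OF assms, symmetric] cdf_convolution[OF assms(2,1), symmetric])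
qed

lemma iid_nonneg_law:
  assumes "prob_space M" and iid: "iid_nonneg M W G"
  shows "real_distribution G" and "t < 0 \<Longrightarrow> cdf G t = 0"
proof -
  note One_nat_def [simp del]
  interpret prob_space M by fact
  have ind: "indep_vars (\<lambda>_. borel) W {1..}" and law: "distr M borel (W 1) = G"
    and nonneg: "AE \<omega> in M. 0 \<le> W 1 \<omega>"
    using iid by (auto simp: iid_nonneg_def)
  have W [measurable]: "random_variable borel (W 1)"
    using ind by (auto simp: indep_vars_def)
  then show "real_distribution G"
    using law real_distribution_distr by blast
  assume "t < 0"
  have "cdf G t = prob {\<omega> \<in> space M. W 1 \<omega> \<le> t}"
    unfolding cdf_def law[symmetric] by (subst measure_distr) (auto intro!: arg_cong[where f = prob])
  also have "\<dots> = 0"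
    by (subst prob_eq_0) (use nonneg \<open>t < 0\<close> in auto)
  finally show "cdf G t = 0" .
qed

section \<open>From geometric divisibility to the mean and back\<close>

context positive_distribution
begin

lemma integrable_switch_mean: "integrable F (\<lambda>s. switch_mean (t - s))"
proof (rule Bochner_Integration.integrable_bound)
  show "integrable F (\<lambda>s. 2 / (1 - laplace1) * exp t * exp (- s))"
    using integrable_exp by simp
  have "\<bar>switch_mean (t - s)\<bar> \<le> \<bar>2 / (1 - laplace1) * exp t * exp (- s)\<bar>" for s
    using abs_switch_mean_le[of "t - s"] laplace1_less_1
    by (simp add: exp_diff exp_minus abs_mult field_simps)
  then show "AE s in F. norm (switch_mean (t - s)) \<le> norm (2 / (1 - laplace1) * exp t * exp (- s))"
    by simp
qed measurable

lemma integral_indicator_diff: "(\<integral>s. indicator {0..} (t - s) \<partial>F) = cdf F t"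
proof -
  have "indicator {0..} (t - s) = (indicator {..t} s :: real)" for s
    by (simp add: indicator_def)
  then show ?thesis
    using space_eq_univ by (simp add: cdf_def)
qed

lemma integrable_indicator_diff: "integrable F (\<lambda>s. indicator {0..} (t - s) :: real)"
  by (rule integrable_const_bound[of _ 1]) (auto simp: indicator_def)

lemma cdf_0: "cdf F 0 = 0"
  unfolding cdf_def by (subst prob_eq_0) (use AE_pos in auto)

text \<open>At time 0 the renewal integral runs over \<open>switch_mean (- s)\<close> with
  \<open>s\<close> almost surely positive, hence vanishes.\<close>

lemma switch_mean_0: "switch_mean 0 = 1"
proof -
  have "(\<integral>s. switch_mean (0 - s) \<partial>F) = (\<integral>s. 0 \<partial>F)"
    by (intro integral_cong_AE) (use AE_pos switch_mean_neg in auto)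
  then show ?thesis
    using switch_mean_renewal[of 0] cdf_0 by simp
qed

text \<open>The hypothesis \<open>eq\<close> says that the tail of \<open>G\<close>, set to 0 on the
  negative axis, solves the renewal equation of \<open>switch_mean\<close>; the difference
  \<open>D\<close> therefore solves the homogeneous one.\<close>

lemma switch_mean_eq_tail:
  assumes G: "real_distribution G" and G_neg: "\<And>t. t < 0 \<Longrightarrow> cdf G t = 0"
    and eq: "\<And>t. cdf F t = 1 / 2 * cdf G t + 1 / 2 * (\<integral>s. cdf G (t - s) \<partial>F)"
    and "0 \<le> t"
  shows "switch_mean t = 1 - cdf G t"
proof -
  interpret G: real_distribution G by fact
  define D where "D x = switch_mean x - indicator {0..} x + cdf G x" for x
  have "D t = 0"
  proof (rule renewal_equation_unique[of D])
    show "D \<in> borel_measurable borel"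
      unfolding D_def[abs_def] by measurable
    \<comment> \<open>The first constant comes from \<open>switch_mean\<close>; the extra 1 covers
      the tail, which is at most 1 where \<open>exp x\<close> is at least 1 and vanishes for
      negative \<open>x\<close>.\<close>
    show "\<bar>D x\<bar> \<le> (2 / (1 - laplace1) + 1) * exp x" for x
    proof -
      have "\<bar>indicator {0..} x - cdf G x\<bar> \<le> exp x"
      proof (cases "x < 0")
        case False
        then have "1 \<le> exp x" by simp
        with False G.cdf_nonneg[of x] G.cdf_bounded_prob[of x] show ?thesis
          by (simp del: one_le_exp_iff)
      qed (simp add: G_neg)
      with abs_switch_mean_le[of x] show ?thesis
        unfolding D_def by (simp only: distrib_right)
    qed
    show "D x = - (\<integral>s. D (x - s) \<partial>F)" for x
    proof -
      have "(\<integral>s. D (x - s) \<partial>F) = (\<integral>s. switch_mean (x - s) \<partial>F) - cdf F x + (\<integral>s. cdf G (x - s) \<partial>F)"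
        unfolding D_def
        by (simp add: integrable_switch_mean integrable_indicator_diff integrable_cdf_diff[OF G]
            integral_indicator_diff)
      then show ?thesis
        using switch_mean_renewal[of x] eq[of x] by (simp add: D_def)
    qed
  qed
  with \<open>0 \<le> t\<close> show ?thesis
    by (simp add: D_def)
qed

text \<open>Here \<open>G\<close> is the law of the summands: for parameter \<open>1 / 2\<close> the
  equation of a geometric sum becomes the hypothesis \<open>eq\<close> of
  \<open>switch_mean_eq_tail\<close> once the convolution is commuted.\<close>

lemma GD_2_imp_switch_mean_tail:
  assumes "F \<in> GD 2"
  obtains G where "real_distribution G" "\<And>t. 0 \<le> t \<Longrightarrow> switch_mean t = 1 - cdf G t"
proof -
  obtain M :: "(nat \<times> (nat \<Rightarrow> real)) measure" and \<nu> W where gs: "geometric_sum M \<nu> W (1 / 2) F"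
    using assms by (auto simp: GD_def)
  then obtain G where iid: "iid_nonneg M W G" and M: "prob_space M"
    by (auto simp: geometric_sum_def)
  note G = iid_nonneg_law[OF M iid]
  have "cdf F t = 1 / 2 * cdf G t + 1 / 2 * (\<integral>s. cdf G (t - s) \<partial>F)" for t
    using geometric_sum_renewal[OF gs iid G(1), of t]
    by (simp add: convolution_commutative_real[OF real_distribution_axioms G(1)])
  then show ?thesis
    using that G switch_mean_eq_tail by blast
qed

text \<open>The function \<open>H\<close>, equal to \<open>1 - switch_mean\<close> on the half-line,
  turns out to be a distribution function. The geometric sum with this summand law satisfies the
  same equation as \<open>F\<close>, so by uniqueness its law is \<open>F\<close>.\<close>

lemma GD_2_if_switch_mean_antimono:
  assumes nonneg: "\<And>t. 0 \<le> t \<Longrightarrow> 0 \<le> switch_mean t" and anti: "antimono_on {0..} switch_mean"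
  shows "F \<in> GD 2"
proof -
  define H where "H t = indicator {0..} t - switch_mean t" for t
  have le_1: "switch_mean t \<le> 1" and ge_0: "0 \<le> switch_mean t" for t
    using monotone_onD[OF anti, of 0 t] nonneg[of t] switch_mean_neg[of t] switch_mean_0
    by (cases "0 \<le> t"; force)+
  have H_neg: "H t = 0" if "t < 0" for t
    using that by (simp add: H_def switch_mean_neg)
  have mono: "H x \<le> H y" if "x \<le> y" for x y
  proof (cases "0 \<le> x")
    case True
    with that monotone_onD[OF anti, of x y] show ?thesis
      by (simp add: H_def)
  next
    case False
    with le_1[of y] switch_mean_neg[of y] H_neg[of x] show ?thesis
      by (cases "0 \<le> y") (auto simp: H_def)
  qed
  have right_cont: "continuous (at_right a) H" for a
  proof -
    \<comment> \<open>The unit step is right-continuous as the distribution function of the point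
      mass at 0.\<close>
    interpret R: real_distribution "return borel (0 :: real)"
      by (rule real_distribution_return)
    have "cdf (return borel 0) = (indicator {0..} :: real \<Rightarrow> real)"
      by (auto simp: cdf_def measure_return indicator_def)
    with R.cdf_is_right_cont[of a] show ?thesis
      unfolding H_def[abs_def] by (intro continuous_diff switch_mean_right_cont) simp
  qed
  have at_bot: "(H \<longlongrightarrow> 0) at_bot"
    by (rule tendsto_eventually) (rule eventually_mono[OF eventually_gt_at_bot[of 0] H_neg])
  have "incseq (\<lambda>n. H (real n))"
    by (intro incseq_SucI mono) simp
  moreover have "H (real n) \<le> 1" for n
    using ge_0 by (simp add: H_def)
  ultimately obtain L where L: "(\<lambda>n. H (real n)) \<longlonglongrightarrow> L"
    using incseq_convergent by blast
  then have H_lim: "(H \<longlongrightarrow> L) at_top"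
    by (intro tendsto_at_topI_sequentially_real monoI mono)
  have mean_lim: "(\<lambda>n. switch_mean (real n - s)) \<longlonglongrightarrow> 1 - L" for s
  proof -
    have lim: "filterlim (\<lambda>n. real n - s) at_top sequentially"
      using filterlim_tendsto_add_at_top[OF tendsto_const[of "- s"] filterlim_real_sequentially] by simp
    have "(\<lambda>n. 1 - H (real n - s)) \<longlonglongrightarrow> 1 - L"
      by (intro tendsto_diff tendsto_const filterlim_compose[OF H_lim lim])
    moreover have "\<forall>\<^sub>F n in sequentially. 1 - H (real n - s) = switch_mean (real n - s)"
      using lim[unfolded filterlim_at_top, rule_format, of 0] by eventually_elim (simp add: H_def)
    ultimately show ?thesis
      by (rule Lim_transform_eventually)
  qed
  \<comment> \<open>The limit is taken in the renewal equation, with the constant 1 as majorant: the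
    limit \<open>1 - L\<close> of the mean also equals \<open>1 - 1 - (1 - L) = L - 1\<close>, which
    forces \<open>L = 1\<close>.\<close>
  have "(\<lambda>n. \<integral>s. switch_mean (real n - s) \<partial>F) \<longlonglongrightarrow> (\<integral>s. 1 - L \<partial>F)"
    by (rule integral_dominated_convergence[where w = "\<lambda>_. 1"]) (use mean_lim le_1 ge_0 in auto)
  then have "(\<lambda>n. 1 - cdf F (real n) - (\<integral>s. switch_mean (real n - s) \<partial>F)) \<longlonglongrightarrow> 1 - 1 - (1 - L)"
    using prob_space by (intro tendsto_diff tendsto_const cdf_lim_infty_prob) simp
  moreover have "1 - cdf F (real n) - (\<integral>s. switch_mean (real n - s) \<partial>F) = switch_mean (real n)" for n
    using switch_mean_renewal[of "real n"] by simp
  ultimately have "(\<lambda>n. switch_mean (real n)) \<longlonglongrightarrow> L - 1"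
    by simp
  with mean_lim[of 0] have "L - 1 = 1 - L"
    using LIMSEQ_unique by fastforce
  then have at_top: "(H \<longlongrightarrow> 1) at_top"
    using H_lim by simp
  define G where "G = interval_measure H"
  have G: "real_distribution G"
    unfolding G_def by (rule real_distribution_interval_measure[OF mono right_cont at_bot at_top])
  have cdf_G: "cdf G = H"
    unfolding G_def by (rule cdf_interval_measure[OF mono right_cont at_bot])
  interpret G: real_distribution G by fact
  \<comment> \<open>\<open>H 0 = 0\<close> because the mean starts at 1, so \<open>G\<close> has no
    mass on \<open>{..0}\<close>.\<close>
  have "G.prob {..0} = 0"
    using fun_cong[OF cdf_G, of 0] switch_mean_0 by (simp add: cdf_def H_def)
  then have "AE s in G. 0 \<le> s"
    by (subst (asm) G.prob_eq_0) auto
  then obtain M :: "(nat \<times> (nat \<Rightarrow> real)) measure" and \<nu> W F'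
    where iid: "iid_nonneg M W G" and gs: "geometric_sum M \<nu> W (1 / 2) F'"
    by (rule geometric_sum_exists[OF G, where p = "1 / 2"]) simp_all
  have "F' = F"
  proof (rule geometric_renewal_unique[OF G])
    show "real_distribution F'"
    proof -
      interpret M: prob_space M
        using gs by (simp add: geometric_sum_def)
      have "F' = distr M borel (\<lambda>\<omega>. \<Sum>k=1..\<nu> \<omega>. W k \<omega>)"
        using gs by (simp add: geometric_sum_def)
      moreover have "(\<lambda>\<omega>. \<Sum>k=1..\<nu> \<omega>. W k \<omega>) \<in> borel_measurable M"
      proof (rule measurable_compose_countable[where f = "\<lambda>n \<omega>. \<Sum>k=1..n. W k \<omega>"])
        have "M.indep_vars (\<lambda>_. borel) W {1..}"
          using iid by (simp add: iid_nonneg_def)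
        then show "(\<lambda>\<omega>. \<Sum>k=1..n. W k \<omega>) \<in> borel_measurable M" for n
          by (intro borel_measurable_sum) (auto simp: M.indep_vars_def)
      qed (use gs in \<open>simp add: geometric_sum_def\<close>)
      ultimately show ?thesis
        by simp
    qed
    show "cdf F' t = 1 / 2 * cdf G t + (1 - 1 / 2) * (\<integral>s. cdf F' (t - s) \<partial>G)" for t
      by (rule geometric_sum_renewal[OF gs iid G]) simp_all
    \<comment> \<open>By the renewal equation the convolution of the mean with \<open>F\<close> is
      \<open>H - cdf F\<close>; hence that of \<open>H\<close> with \<open>F\<close> is
      \<open>2 * cdf F - H\<close>.\<close>
    show "cdf F t = 1 / 2 * cdf G t + (1 - 1 / 2) * (\<integral>s. cdf F (t - s) \<partial>G)" for t
    proof -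
      have "(\<integral>s. cdf F (t - s) \<partial>G) = (\<integral>s. H (t - s) \<partial>F)"
        using convolution_commutative_real[OF real_distribution_axioms G] by (simp add: cdf_G)
      also have "\<dots> = cdf F t - (\<integral>s. switch_mean (t - s) \<partial>F)"
        unfolding H_def
        by (simp add: integrable_switch_mean integrable_indicator_diff integral_indicator_diff)
      finally show ?thesis
        using switch_mean_renewal[of t] by (simp add: cdf_G H_def field_simps)
    qed
  qed (simp_all add: real_distribution_axioms)
  with gs show ?thesis
    unfolding GD_def by auto
qed

end

lemma positive_distribution_switching_time:
  assumes "switching_time_distribution F"
  shows "positive_distribution F"
proof -
  interpret real_distribution F
    using assms by (simp add: switching_time_distribution_def)
  have "prob {0<..} = 1"
    using assms by (simp add: switching_time_distribution_def)
  then have "AE s in F. 0 < s"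
    by (subst (asm) prob_eq_1) auto
  then show ?thesis
    by unfold_locales
qed

theorem theorem1:
  fixes M :: "'a measure" and T :: "nat \<Rightarrow> 'a \<Rightarrow> real" and F :: "real measure"
  assumes "prob_space M"
    and "switching_time_distribution F"
    and "iid_nonneg M T F"
  shows "F \<in> GD 2 \<longleftrightarrow>
    (\<forall>t\<ge>0. 0 \<le> expected_value M T t) \<and> antimono_on {0..} (expected_value M T)"
proof -
  have pos: "positive_distribution F"
    by (rule positive_distribution_switching_time) fact
  interpret F: positive_distribution F by fact
  have E: "expected_value M T t = F.switch_mean t" if "0 \<le> t" for t
    by (rule prob_space.expected_value_eq_switch_mean[OF assms(1,3) pos that])
  have "F \<in> GD 2 \<longleftrightarrow> (\<forall>t\<ge>0. 0 \<le> F.switch_mean t) \<and> antimono_on {0..} F.switch_mean"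
  proof
    assume "F \<in> GD 2"
    then obtain G where G: "real_distribution G"
      and tail: "\<And>t. 0 \<le> t \<Longrightarrow> F.switch_mean t = 1 - cdf G t"
      by (rule F.GD_2_imp_switch_mean_tail) blast
    interpret G: real_distribution G by fact
    show "(\<forall>t\<ge>0. 0 \<le> F.switch_mean t) \<and> antimono_on {0..} F.switch_mean"
      by (auto simp: tail G.cdf_bounded_prob G.cdf_nondecreasing intro!: monotone_onI)
  next
    assume "(\<forall>t\<ge>0. 0 \<le> F.switch_mean t) \<and> antimono_on {0..} F.switch_mean"
    then show "F \<in> GD 2"
      by (intro F.GD_2_if_switch_mean_antimono) auto
  qed
  also have "\<dots> \<longleftrightarrow> (\<forall>t\<ge>0. 0 \<le> expected_value M T t) \<and> antimono_on {0..} (expected_value M T)"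
    by (auto simp: E monotone_on_def)
  finally show ?thesis .
qed

end
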